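(* Let $d,k\in\mathbb N$, let $(U,\mathcal F)$ be an instance of \textsc{$d$-Hitting Set}, and let $(U',\mathcal F')$ be defined as in the context: $\mathcal F'$ is the family of inclusion-minimal good sets and $U'=\bigcup_{S\in\mathcal F'}S$. If $(U,\mathcal F)$ (and hence also $(U',\mathcal F')$) admits a hitting set of size at most $k$, then $$|U'|\le d\,|\mathcal F'| \quad\text{and}\quad |\mathcal F'|\le \left(1+\frac{2}{(k+1)(d-1)}\right)\cdot d!\,(k+1)^{d}.$$
   Context: An instance $(U,\mathcal F)$ of \textsc{$d$-Hitting Set} consists of a universe $U$ and a family $\mathcal F$ of subsets of $U$, each of cardinality exactly $d$; the parameter $k\in\mathbb N$ is the allowed size of a hitting set. A hitting set of a family of sets is a set of elements that intersects every set in the family. For $r\in\mathbb N$ let $\nu_r = r!\,(k+1)^r$. The notion of an "$(\ell,r)$-good" set is defined inductively, in decreasing order of $\ell$ from $d$ to $1$, and for fixed $\ell$, for increasing $r$ from $1$ to $d-\ell$: \begin{itemize} \item Any set $S\in\mathcal F$ is $(d,r)$-good for all $r$. \item A set $S\subseteq U$ is $\ell$-good if $S$ is $(\ell,r)$-good for some $r$. \item A set $S\subseteq U$ is $(\ell',r)$-strong if $S$ is $\ell'$-good and does not contain any $(\ell'-j,j)$-good subsets for any $j\in\{1,\dots,r-1\}$. \item A set $S\subseteq U$ is $(\ell,r)$-good if $S$ is of size $\ell$ and is contained in at least $\nu_r$ sets that are $(\ell+r,r)$-strong. \item A set $S\subseteq U$ is good if $S$ is $\ell$-good for $\ell=|S|$.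 \end{itemize} $\mathcal F'$ consists of those sets $S\subseteq U$ that are good and none of whose proper subsets are good; $U'$ consists of all $u\in U$ that are contained in some set of $\mathcal F'$.
   Formalization: For d = k = 0 the bound on |F'| would read 0 ≤ −1 and fails, so that inequality is not claimed for this pair; for d = 1, where the printed bound divides by zero, the term 2/((k+1)(d−1)) is read as 0, giving |F'| ≤ k+1. *)

theory Defs
  imports Complex_Main
begin

text \<open>An instance of \<open>d\<close>-Hitting Set. Instances are finite objects, as usual for this problem.\<close>

definition hs_instance :: "nat \<Rightarrow> 'a set \<Rightarrow> 'a set set \<Rightarrow> bool" where
  "hs_instance d U F \<longleftrightarrow> finite U \<and> F \<subseteq> Pow U \<and> (\<forall>S\<in>F. card S = d)"

definition hitting_set :: "'a set set \<Rightarrow> 'a set \<Rightarrow> bool" where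
  "hitting_set F H \<longleftrightarrow> (\<forall>S\<in>F. H \<inter> S \<noteq> {})"

definition has_hitting_set :: "nat \<Rightarrow> 'a set \<Rightarrow> 'a set set \<Rightarrow> bool" where
  "has_hitting_set k U F \<longleftrightarrow> (\<exists>H. H \<subseteq> U \<and> finite H \<and> card H \<le> k \<and> hitting_set F H)"

definition nu :: "nat \<Rightarrow> nat \<Rightarrow> nat" where
  "nu k r = fact r * (k + 1) ^ r"

text \<open>
  \<open>lr_good d k U F l r S\<close> says that \<open>S\<close> is \<open>(l, r)\<close>-good. Below \<open>l = d\<close>, the notion exists only
  for \<open>1 \<le> l\<close> and \<open>1 \<le> r \<le> d - l\<close>; in particular the empty set is never good when \<open>d \<ge> 1\<close>.
  Strong sets are written out here because their definition recurs through goodness at larger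
  \<open>l\<close>; the lemma \<open>lr_good_iff\<close> restates the recursion in terms of strong sets.
\<close>

context
  notes conj_cong [fundef_cong]
begin

function lr_good ::
    "nat \<Rightarrow> nat \<Rightarrow> 'a set \<Rightarrow> 'a set set \<Rightarrow> nat \<Rightarrow> nat \<Rightarrow> 'a set \<Rightarrow> bool" where
  "lr_good d k U F l r S \<longleftrightarrow>
     (if l = d then S \<in> F
      else 1 \<le> l \<and> 1 \<le> r \<and> l + r \<le> d \<and> S \<subseteq> U \<and> card S = l \<and>
           nu k r \<le> card {T. T \<subseteq> U \<and> S \<subseteq> T \<and>
             (\<exists>r'. lr_good d k U F (l + r) r' T) \<and>
             \<not> (\<exists>j X. (1 \<le> j \<and> j < r) \<and> X \<subseteq> T \<and> lr_good d k U F (l + r - j) j X)})"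
  by pat_completeness auto

termination
  by (relation "measure (\<lambda>(d, k, U, F, l, r, S). d - l)") auto

end

declare lr_good.simps [simp del]

definition l_good :: "nat \<Rightarrow> nat \<Rightarrow> 'a set \<Rightarrow> 'a set set \<Rightarrow> nat \<Rightarrow> 'a set \<Rightarrow> bool" where
  "l_good d k U F l S \<longleftrightarrow> S \<subseteq> U \<and> (\<exists>r. lr_good d k U F l r S)"

definition strong ::
    "nat \<Rightarrow> nat \<Rightarrow> 'a set \<Rightarrow> 'a set set \<Rightarrow> nat \<Rightarrow> nat \<Rightarrow> 'a set \<Rightarrow> bool" where
  "strong d k U F l r S \<longleftrightarrow>
     S \<subseteq> U \<and> l_good d k U F l S \<and>
     \<not> (\<exists>j X. (1 \<le> j \<and> j < r) \<and> X \<subseteq> S \<and> lr_good d k U F (l - j) j X)"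

lemma lr_good_top: "lr_good d k U F d r S \<longleftrightarrow> S \<in> F"
  by (simp add: lr_good.simps)

lemma lr_good_iff:
  assumes "1 \<le> l" "1 \<le> r" "l + r \<le> d"
  shows "lr_good d k U F l r S \<longleftrightarrow>
    S \<subseteq> U \<and> card S = l \<and> nu k r \<le> card {T. S \<subseteq> T \<and> strong d k U F (l + r) r T}"
proof -
  have "{T. S \<subseteq> T \<and> strong d k U F (l + r) r T} =
    {T. T \<subseteq> U \<and> S \<subseteq> T \<and> (\<exists>r'. lr_good d k U F (l + r) r' T) \<and>
        \<not> (\<exists>j X. (1 \<le> j \<and> j < r) \<and> X \<subseteq> T \<and> lr_good d k U F (l + r - j) j X)}"
    unfolding strong_def l_good_def by blast
  then show ?thesis
    using assms by (subst lr_good.simps) simp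
qed

definition good :: "nat \<Rightarrow> nat \<Rightarrow> 'a set \<Rightarrow> 'a set set \<Rightarrow> 'a set \<Rightarrow> bool" where
  "good d k U F S \<longleftrightarrow> S \<subseteq> U \<and> l_good d k U F (card S) S"

definition kernel_family :: "nat \<Rightarrow> nat \<Rightarrow> 'a set \<Rightarrow> 'a set set \<Rightarrow> 'a set set" where
  "kernel_family d k U F = {S. S \<subseteq> U \<and> good d k U F S \<and> (\<forall>T. T \<subset> S \<longrightarrow> \<not> good d k U F T)}"

definition kernel_universe :: "nat \<Rightarrow> nat \<Rightarrow> 'a set \<Rightarrow> 'a set set \<Rightarrow> 'a set" where
  "kernel_universe d k U F = {u \<in> U. \<exists>S \<in> kernel_family d k U F. u \<in> S}"

end

(* Every hitting set H of F hits every good set. Indeed, if H misses an (l, r)-good set S but hits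
   all larger good sets, then each of the at least nu r strong sets T above S contains S \<union> {v} for
   some v in H. For fixed v there are at most nu (r - 1) of these, as otherwise S \<union> {v} would be
   (l + 1, r - 1)-good, which strength of T forbids. This contradicts k * nu (r - 1) < nu r.
   Similarly, minimality bounds the number of sets of size l in the kernel that contain a fixed
   v in H by nu (l - 1), and k * (nu 0 + ... + nu (d - 1)) <= nu d. *)

theory Submission
  imports Defs
begin

section \<open>Counting along a hitting set, and growth of \<open>nu\<close>\<close>

text \<open>Union bound over \<open>H\<close>; an infinite \<open>A\<close> is harmless because its
  \<open>card\<close> is 0.\<close>

lemma card_le_if_hit:
  assumes "finite H" "hitting_set A H" "\<And>v. v \<in> H \<Longrightarrow> card {T \<in> A. v \<in> T} \<le> m"
  shows "card A \<le> card H * m"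
proof (cases "finite A")
  case True
  have "A \<subseteq> (\<Union>v\<in>H. {T \<in> A. v \<in> T})"
    using assms(2) unfolding hitting_set_def by blast
  then have "card A \<le> card (\<Union>v\<in>H. {T \<in> A. v \<in> T})"
    by (rule card_mono[rotated]) (use True assms(1) in auto)
  also have "\<dots> \<le> (\<Sum>v\<in>H. card {T \<in> A. v \<in> T})"
    using assms(1) by (rule card_UN_le)
  also have "\<dots> \<le> card H * m"
    using sum_bounded_above[of H _ m] assms(3) by simp
  finally show ?thesis .
qed simp

lemma card_supersets_of_same_card_le_1:
  assumes "finite U" "card X = n" "\<And>T. T \<in> A \<Longrightarrow> T \<subseteq> U \<and> X \<subseteq> T \<and> card T = n"
  shows "card A \<le> 1"
proof -
  have "T = X" if "T \<in> A" for T
    using assms(2) assms(3)[OF that] assms(1) by (metis card_subset_eq finite_subset)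
  then have "A \<subseteq> {X}" by blast
  then show ?thesis
    using card_mono[of "{X}" A] by simp
qed

lemma nu_0 [simp]: "nu k 0 = 1"
  by (simp add: nu_def)

lemma nu_Suc: "nu k (Suc r) = Suc r * (k + 1) * nu k r"
  by (simp add: nu_def algebra_simps)

lemma nu_pos: "0 < nu k r"
  by (simp add: nu_def)

text \<open>\<open>nu k\<close> grows by a factor of at least \<open>k + 1\<close> per step: one
  copy of \<open>nu k n\<close> absorbs all earlier terms, the other \<open>k\<close> copies are the
  new term.\<close>

lemma sum_nu_le: "k * (\<Sum>r<n. nu k r) \<le> nu k n"
proof (induction n)
  case (Suc n)
  have "k * (\<Sum>r<Suc n. nu k r) \<le> nu k n + k * nu k n"
    using Suc by (simp add: distrib_left)
  also have "\<dots> \<le> nu k (Suc n)"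
    by (simp add: nu_Suc algebra_simps)
  finally show ?case .
qed simp

section \<open>Good and strong sets\<close>

lemma lr_goodD:
  assumes "hs_instance d U F" "lr_good d k U F l r S"
  shows "S \<subseteq> U" "card S = l" "l = d \<or> 1 \<le> l \<and> 1 \<le> r \<and> l + r \<le> d"
proof -
  have "if l = d then S \<in> F else 1 \<le> l \<and> 1 \<le> r \<and> l + r \<le> d \<and> S \<subseteq> U \<and> card S = l"
    using assms(2) by (subst (asm) lr_good.simps) (simp split: if_splits)
  then show "S \<subseteq> U" "card S = l" "l = d \<or> 1 \<le> l \<and> 1 \<le> r \<and> l + r \<le> d"
    using assms(1) by (auto simp: hs_instance_def split: if_splits)
qed

lemma good_iff:
  assumes "hs_instance d U F"
  shows "good d k U F S \<longleftrightarrow> (\<exists>l r. lr_good d k U F l r S)"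
  unfolding good_def l_good_def by (auto dest: lr_goodD(1,2)[OF assms])

lemma strong_card:
  assumes "hs_instance d U F" "strong d k U F l r T"
  shows "T \<subseteq> U" "card T = l"
  using assms(2) unfolding strong_def l_good_def by (auto dest: lr_goodD(2)[OF assms(1)])

text \<open>A smaller second index forbids fewer subsets. This is used after adding a point of
  \<open>H\<close> to a set, which lowers the index by one.\<close>

lemma strong_antimono:
  assumes "strong d k U F l r T" "r' \<le> r"
  shows "strong d k U F l r' T"
  using assms less_le_trans[of _ r' r] unfolding strong_def by blast

text \<open>
  Strength of members of \<open>A\<close> prevents \<open>X\<close> from being good, so that \<open>A\<close> is small; the case
  \<open>n = card X\<close> is covered by \<open>nu k 0 = 1\<close>.
\<close>

lemma card_strong_supersets_le:
  assumes inst: "hs_instance d U F"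
    and X: "X \<subseteq> U" "1 \<le> card X" "card X \<le> n" "n \<le> d"
    and A: "\<And>T. T \<in> A \<Longrightarrow> X \<subseteq> T \<and> strong d k U F n (n - card X) T"
    and not_good: "\<And>T. T \<in> A \<Longrightarrow> card X < n \<Longrightarrow> \<not> lr_good d k U F (card X) (n - card X) X"
  shows "card A \<le> nu k (n - card X)"
proof -
  have fin: "finite U" using inst by (simp add: hs_instance_def)
  show ?thesis
  proof (cases "card X = n")
    case True
    then show ?thesis
      using card_supersets_of_same_card_le_1[OF fin True, of A] A strong_card[OF inst]
      by (metis diff_self_eq_0 nu_0)
  next
    case False
    show ?thesis
    proof (rule ccontr)
      assume large: "\<not> ?thesis"
      \<comment> \<open>A witness is required because \<open>not_good\<close> only speaks about
        members of \<open>A\<close>.\<close>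
      then have "A \<noteq> {}" by auto
      then obtain T where T: "T \<in> A" by blast
      let ?B = "{T. X \<subseteq> T \<and> strong d k U F n (n - card X) T}"
      \<comment> \<open>Goodness of \<open>X\<close> counts all of \<open>?B\<close>, so
        \<open>A\<close> has to be compared with a finite set.\<close>
      have "finite ?B"
        by (rule finite_subset[of _ "Pow U"]) (use fin in \<open>auto simp: strong_def\<close>)
      moreover have "A \<subseteq> ?B" using A by blast
      ultimately have "card A \<le> card ?B" by (rule card_mono)
      then have "lr_good d k U F (card X) (n - card X) X"
        using large X False by (subst lr_good_iff) auto
      then show False using not_good[OF T] X False by simp
    qed
  qed
qed

section \<open>Hitting sets of \<open>F\<close> meet all good sets\<close>

lemma hitting_set_good:
  assumes inst: "hs_instance d U F"
    and H: "H \<subseteq> U" "finite H" "card H \<le> k" "hitting_set F H"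
    and "lr_good d k U F l r S"
  shows "H \<inter> S \<noteq> {}"
  using assms(6)
\<comment> \<open>Larger sizes come first, as in the recursion of \<open>lr_good\<close>, so
  \<open>H\<close> already hits the strong supersets of size \<open>l + r\<close>.\<close>
proof (induction "d - l" arbitrary: l r S rule: less_induct)
  case less
  show ?case
  proof (cases "l = d")
    case True
    then show ?thesis using less.prems H(4) by (simp add: lr_good_top hitting_set_def)
  next
    case False
    then have lr: "1 \<le> l" "1 \<le> r" "l + r \<le> d"
      using lr_goodD(3)[OF inst less.prems] by auto
    let ?A = "{T. S \<subseteq> T \<and> strong d k U F (l + r) r T}"
    have S: "S \<subseteq> U" "card S = l" "nu k r \<le> card ?A"
      using less.prems lr by (simp_all add: lr_good_iff)
    have finS: "finite S" using S lr by (metis card.infinite not_one_le_zero)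
    show ?thesis
    proof
      assume miss: "H \<inter> S = {}"
      have "hitting_set ?A H"
        unfolding hitting_set_def
      proof safe
        fix T assume "strong d k U F (l + r) r T" "H \<inter> T = {}"
        then obtain r' where "lr_good d k U F (l + r) r' T"
          unfolding strong_def l_good_def by blast
        moreover have "d - (l + r) < d - l" using lr by simp
        ultimately show False using less.hyps \<open>H \<inter> T = {}\<close> by blast
      qed
      moreover have "card {T \<in> ?A. v \<in> T} \<le> nu k (r - 1)" if v: "v \<in> H" for v
      proof -
        have cX: "card (insert v S) = Suc l" using v miss S(2) finS by (simp add: disjoint_iff)
        have "card {T \<in> ?A. v \<in> T} \<le> nu k (l + r - card (insert v S))"
        proof (rule card_strong_supersets_le[OF inst])
          fix T assume T: "T \<in> {T \<in> ?A. v \<in> T}"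
          show "insert v S \<subseteq> T \<and>
              strong d k U F (l + r) (l + r - card (insert v S)) T"
            using T cX by (auto elim: strong_antimono)
          assume "card (insert v S) < l + r"
          \<comment> \<open>Here \<open>r\<close> is at least 2, so \<open>j = r - 1\<close> is
            among the indices that strength of \<open>T\<close> rules out.\<close>
          then have "1 \<le> r - 1" "r - 1 < r" "l + r - (r - 1) = Suc l" using cX by auto
          moreover have "strong d k U F (l + r) r T" "insert v S \<subseteq> T" using T by auto
          ultimately have "\<not> lr_good d k U F (Suc l) (r - 1) (insert v S)"
            unfolding strong_def by metis
          then show "\<not> lr_good d k U F (card (insert v S)) (l + r - card (insert v S)) (insert v S)"
            using cX by simp
        qed (use v H(1) S cX lr in auto)
        then show ?thesis using cX by simp
      qed
      ultimately have "card ?A \<le> card H * nu k (r - 1)"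
        by (rule card_le_if_hit[OF H(2)])
      also have "\<dots> \<le> k * nu k (r - 1)" using H(3) by simp
      also have "\<dots> < (k + 1) * nu k (r - 1)" using nu_pos by simp
      also have "\<dots> \<le> r * ((k + 1) * nu k (r - 1))" using lr by simp
      also have "\<dots> = nu k r"
        using lr nu_Suc[of k "r - 1"] by (simp only: Suc_diff_1 mult.assoc)
      finally show False using S by simp
    qed
  qed
qed

section \<open>Minimal good sets and the size of the kernel\<close>

lemma kernel_family_good:
  assumes "S \<in> kernel_family d k U F"
  obtains r where "lr_good d k U F (card S) r S"
  using assms unfolding kernel_family_def good_def l_good_def by blast

lemma kernel_family_minimal:
  assumes "hs_instance d U F" "S \<in> kernel_family d k U F" "X \<subset> S"
  shows "\<not> lr_good d k U F l r X"
proof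
  assume "lr_good d k U F l r X"
  then have "good d k U F X" using good_iff[OF assms(1)] by blast
  then show False using assms(2,3) by (simp add: kernel_family_def)
qed

lemma kernel_family_card_le:
  assumes "hs_instance d U F" "S \<in> kernel_family d k U F"
  shows "card S \<le> d"
proof -
  obtain r where "lr_good d k U F (card S) r S"
    using assms(2) by (rule kernel_family_good)
  then show ?thesis
    using lr_goodD(3)[OF assms(1)] by fastforce
qed

text \<open>The bound on \<open>r\<close> keeps \<open>card S - j\<close> strictly below
  \<open>card S\<close>, so a subset violating strength would be a proper good subset, against
  minimality.\<close>

lemma kernel_family_strong:
  assumes inst: "hs_instance d U F" and S: "S \<in> kernel_family d k U F" and "r \<le> card S"
  shows "strong d k U F (card S) r S"
proof -
  have "\<not> lr_good d k U F (card S - j) j X" if "1 \<le> j" "j < r" "X \<subseteq> S" for j X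
  proof
    assume X: "lr_good d k U F (card S - j) j X"
    then have "X \<subset> S" using that assms(3) lr_goodD(2)[OF inst X] by auto
    then show False using kernel_family_minimal[OF inst S] X by blast
  qed
  moreover have "S \<subseteq> U" "l_good d k U F (card S) S"
    using S by (simp_all add: kernel_family_def good_def)
  ultimately show ?thesis
    unfolding strong_def by blast
qed

lemma hitting_set_kernel_family:
  assumes "hs_instance d U F" "H \<subseteq> U" "finite H" "card H \<le> k" "hitting_set F H"
  shows "hitting_set (kernel_family d k U F) H"
  unfolding hitting_set_def
proof
  fix S assume "S \<in> kernel_family d k U F"
  then obtain r where "lr_good d k U F (card S) r S"
    by (rule kernel_family_good)
  then show "H \<inter> S \<noteq> {}" by (rule hitting_set_good[OF assms])
qed

lemma finite_kernel_family:
  assumes "hs_instance d U F"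
  shows "finite (kernel_family d k U F)"
  by (rule finite_subset[of _ "Pow U"])
    (use assms in \<open>auto simp: kernel_family_def hs_instance_def\<close>)

lemma card_kernel_universe_le:
  assumes "hs_instance d U F"
  shows "card (kernel_universe d k U F) \<le> d * card (kernel_family d k U F)"
proof -
  let ?K = "kernel_family d k U F"
  have "kernel_universe d k U F = (\<Union>S\<in>?K. S)"
    unfolding kernel_universe_def kernel_family_def by blast
  then have "card (kernel_universe d k U F) \<le> (\<Sum>S\<in>?K. card S)"
    using card_UN_le[OF finite_kernel_family[OF assms], of "\<lambda>S. S"] by simp
  also have "\<dots> \<le> card ?K * d"
    using sum_bounded_above[of ?K card d] kernel_family_card_le[OF assms] by simp
  finally show ?thesis by (simp add: mult.commute)
qed

lemma card_kernel_layer_le: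
  assumes inst: "hs_instance d U F"
    and H: "H \<subseteq> U" "finite H" "card H \<le> k" "hitting_set F H"
    and l: "1 \<le> l" "l \<le> d"
  shows "card {S \<in> kernel_family d k U F. card S = l} \<le> k * nu k (l - 1)"
proof -
  let ?A = "{S \<in> kernel_family d k U F. card S = l}"
  have "hitting_set ?A H"
    using hitting_set_kernel_family[OF inst H] by (simp add: hitting_set_def)
  moreover have "card {T \<in> ?A. v \<in> T} \<le> nu k (l - 1)" if "v \<in> H" for v
  proof -
    \<comment> \<open>The singleton \<open>{v}\<close> serves as \<open>X\<close>: for
      \<open>l > 1\<close> it is a proper subset of a minimal good set, hence not good.\<close>
    have "card {T \<in> ?A. v \<in> T} \<le> nu k (l - card {v})"
    proof (rule card_strong_supersets_le[OF inst])
      fix T assume T: "T \<in> {T \<in> ?A. v \<in> T}"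
      then show "{v} \<subseteq> T \<and> strong d k U F l (l - card {v}) T"
        using kernel_family_strong[OF inst, of T k "l - 1"] by auto
      assume "card {v} < l"
      then have "{v} \<subset> T" using T by auto
      then show "\<not> lr_good d k U F (card {v}) (l - card {v}) {v}"
        using kernel_family_minimal[OF inst] T by blast
    qed (use that H(1) l in auto)
    then show ?thesis by simp
  qed
  ultimately have "card ?A \<le> card H * nu k (l - 1)"
    by (rule card_le_if_hit[OF H(2)])
  also have "\<dots> \<le> k * nu k (l - 1)" using H(3) by simp
  finally show ?thesis .
qed

lemma card_kernel_family_le:
  assumes inst: "hs_instance d U F"
    and H: "H \<subseteq> U" "finite H" "card H \<le> k" "hitting_set F H"
  shows "card (kernel_family d k U F) \<le> k * (\<Sum>r<d. nu k r)"
proof -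
  let ?K = "kernel_family d k U F"
  \<comment> \<open>Layers are indexed by \<open>r = card S - 1\<close>. The empty set is excluded
    because nothing hits it.\<close>
  have "?K \<subseteq> (\<Union>r<d. {S \<in> ?K. card S = Suc r})"
  proof
    fix S assume S: "S \<in> ?K"
    then have "S \<subseteq> U" by (simp add: kernel_family_def)
    moreover have "S \<noteq> {}"
      using hitting_set_kernel_family[OF inst H] S by (auto simp: hitting_set_def)
    ultimately have "card S \<noteq> 0"
      using inst by (metis card_0_eq finite_subset hs_instance_def)
    then obtain r where "card S = Suc r" using not0_implies_Suc by blast
    then show "S \<in> (\<Union>r<d. {S \<in> ?K. card S = Suc r})"
      using S kernel_family_card_le[OF inst S] by auto
  qed
  then have "card ?K \<le> card (\<Union>r<d. {S \<in> ?K. card S = Suc r})"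
    by (rule card_mono[rotated]) (use finite_kernel_family[OF inst] in auto)
  also have "\<dots> \<le> (\<Sum>r<d. card {S \<in> ?K. card S = Suc r})"
    by (rule card_UN_le) simp
  also have "\<dots> \<le> (\<Sum>r<d. k * nu k r)"
  proof (rule sum_mono)
    fix r assume "r \<in> {..<d}"
    then show "card {S \<in> ?K. card S = Suc r} \<le> k * nu k r"
      using card_kernel_layer_le[OF inst H, of "Suc r"] by simp
  qed
  finally show ?thesis by (simp add: sum_distrib_left)
qed

theorem lemma2:
  fixes d k :: nat and U :: "'a set" and F :: "'a set set"
  assumes "hs_instance d U F"
    and "has_hitting_set k U F"
  shows "has_hitting_set k (kernel_universe d k U F) (kernel_family d k U F) \<and>
    card (kernel_universe d k U F) \<le> d * card (kernel_family d k U F) \<and>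
    (\<not> (d = 0 \<and> k = 0) \<longrightarrow>
      real (card (kernel_family d k U F)) \<le>
        (1 + 2 / ((real k + 1) * (real d - 1))) * fact d * (real k + 1) ^ d)"
proof (intro conjI impI)
  let ?K = "kernel_family d k U F" and ?V = "kernel_universe d k U F"
  obtain H where H: "H \<subseteq> U" "finite H" "card H \<le> k" "hitting_set F H"
    using assms(2) unfolding has_hitting_set_def by blast
  have "S \<subseteq> ?V" if "S \<in> ?K" for S
    using that by (auto simp: kernel_universe_def kernel_family_def)
  \<comment> \<open>\<open>H\<close> may leave the new universe; restricting it to \<open>?V\<close>
    loses nothing, as members of \<open>?K\<close> lie inside \<open>?V\<close>.\<close>
  then have "hitting_set ?K (H \<inter> ?V)"
    using hitting_set_kernel_family[OF assms(1) H]
    by (simp add: hitting_set_def Int_assoc Int_absorb1)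
  moreover have "card (H \<inter> ?V) \<le> k"
    using H(2,3) card_mono[of H "H \<inter> ?V"] by simp
  ultimately show "has_hitting_set k ?V ?K"
    unfolding has_hitting_set_def using H(2) by (intro exI[of _ "H \<inter> ?V"]) simp
  show "card ?V \<le> d * card ?K"
    using assms(1) by (rule card_kernel_universe_le)
  \<comment> \<open>For \<open>d = k = 0\<close> the right-hand side would be
    \<open>-1\<close>.\<close>
  assume nz: "\<not> (d = 0 \<and> k = 0)"
  have K: "card ?K \<le> k * (\<Sum>r<d. nu k r)"
    using assms(1) H by (rule card_kernel_family_le)
  show "real (card ?K) \<le>
      (1 + 2 / ((real k + 1) * (real d - 1))) * fact d * (real k + 1) ^ d"
  proof (cases "d = 0")
    case True
    \<comment> \<open>The kernel is empty, and the factor is \<open>1 - 2 / (k + 1) \<ge> 0\<close>.\<close>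
    then show ?thesis using K nz by (simp add: field_simps)
  next
    case False
    have "real (card ?K) \<le> real (nu k d)"
      using K sum_nu_le[of k d] by (simp only: of_nat_le_iff)
    also have "\<dots> = 1 * (fact d * (real k + 1) ^ d)"
      by (simp add: nu_def add.commute)
    \<comment> \<open>The added fraction is nonnegative: for \<open>d = 1\<close> it is
      \<open>2 / 0 = 0\<close>, for larger \<open>d\<close> it is positive.\<close>
    also have "\<dots> \<le> (1 + 2 / ((real k + 1) * (real d - 1))) * (fact d * (real k + 1) ^ d)"
      using False by (intro mult_right_mono) auto
    finally show ?thesis by (simp only: mult.assoc)
  qed
qed

end
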